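(* Consider an $n$-player game ($n\ge 4$) with two groups $G_1=\{1,\dots,m\}$ and $G_2=\{m+1,\dots,n\}$, $2\le m\le n-2$, which is zero-sum and symmetric in each group and satisfies all the standing assumptions listed in the context. Suppose that Sion's minimax theorem with the coincidence of the maximin strategy and the minimax strategy holds in each group, i.e. there exist $\tilde s\in S$ and $\hat s\in S'$ such that for all distinct $i,j\in G_1$ and all distinct $k,l\in G_2$: $$\max_{s_i\in S}\min_{s_j\in S}u_i(s_i,s_j,\tilde s,\dots,\tilde s,\hat s,\dots,\hat s)=\min_{s_j\in S}\max_{s_i\in S}u_i(s_i,s_j,\tilde s,\dots,\tilde s,\hat s,\dots,\hat s),$$ $$\tilde s=\arg\max_{s_i\in S}\min_{s_j\in S}u_i(s_i,s_j,\tilde s,\dots,\tilde s,\hat s,\dots,\hat s)=\arg\min_{s_j\in S}\max_{s_i\in S}u_i(s_i,s_j,\tilde s,\dots,\tilde s,\hat s,\dots,\hat s),$$ $$\max_{s_k\in S'}\min_{s_l\in S'}u_k(\tilde s,\dots,\tilde s,s_k,s_l,\hat s,\dots,\hat s)=\min_{s_l\in S'}\max_{s_k\in S'}u_k(\tilde s,\dots,\tilde s,s_k,s_l,\hat s,\dots,\hat s),$$ $$\hat s=\arg\max_{s_k\in S'}\min_{s_l\in S'}u_k(\tilde s,\dots,\tilde s,s_k,s_l,\hat s,\dots,\hat s)=\arg\min_{s_l\in S'}\max_{s_k\in S'}u_k(\tilde s,\dots,\tilde s,s_k,s_l,\hat s,\dots,\hat s).$$ Then the game has a Nash equilibrium which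 is symmetric in each group, i.e. a Nash equilibrium in which all players in $G_1$ choose one common strategy in $S$ and all players in $G_2$ choose one common strategy in $S'$.
   Context: Game. There are $n\ge 4$ players, divided into $G_1=\{1,\dots,m\}$ and $G_2=\{m+1,\dots,n\}$ with $2\le m\le n-2$. Player $i$ has strategy set $S_i$, a nonempty convex compact subset of a linear topological space, and payoff function $u_i:S_1\times\cdots\times S_n\to\mathbb{R}$. Players in the same group have the same strategy set: $S_i=S$ for $i\in G_1$ and $S_k=S'$ for $k\in G_2$. Standing assumptions. (1) Each $u_i$ is continuous on $S_1\times\cdots\times S_n$, quasi-concave in $s_i$ for any fixed strategies of the other players, and, for each $j\ne i$, quasi-convex in $s_j$ for any fixed strategies of the players other than $j$. (2) Zero-sum in each group: $\sum_{i\in G_1}u_i(s_1,\dots,s_n)=0$ and $\sum_{k\in G_2}u_k(s_1,\dots,s_n)=0$ for every $(s_1,\dots,s_n)$. (3) Symmetric in each group (players in a group have the same payoff functions): for every permutation $\pi$ of $\{1,\dots,n\}$ with $\pi(G_1)=G_1$ and $\pi(G_2)=G_2$, every player $i$ and every profile $(s_1,\dots,s_n)$, $u_{\pi(i)}(s_1,\dots,s_n)=u_i(s_{\pi(1)},\dots,s_{\pi(n)})$. (4) Uniqueness: for any distinct $i,j$ in the same group and any fixed strategies of all players other than $i,j$, the set $\arg\max_{s_i}\min_{s_j}u_i$ (maximin strategy) and the set $\arg\min_{s_j}\max_{s_i}u_i$ (minimax strategy) are singletons, and are identified with their unique element; likewise for any player $i$ and any fixed strategies of the others, the best response $\arg\max_{s_i}u_i$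 is unique. Notation. $(s_i,s_j,\tilde s,\dots,\tilde s,\hat s,\dots,\hat s)$ is the profile in which players $i,j\in G_1$ choose $s_i,s_j$, all other players in $G_1$ choose $\tilde s$, and all players in $G_2$ choose $\hat s$. $(\tilde s,\dots,\tilde s,s_k,s_l,\hat s,\dots,\hat s)$ is the profile in which all players in $G_1$ choose $\tilde s$, players $k,l\in G_2$ choose $s_k,s_l$, and all other players in $G_2$ choose $\hat s$. A Nash equilibrium is a profile $(s_1^*,\dots,s_n^* )$ such that for every player $i$ and every $s_i\in S_i$, $u_i(s_1^*,\dots,s_i^*,\dots,s_n^* )\ge u_i(s_1^*,\dots,s_i,\dots,s_n^* )$. *)

theory Defs
  imports "HOL-Analysis.Analysis"
begin

(* Real linear topological spaces. The Hausdorff property is not required.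
   As for the other topological algebra classes of Limits, joint continuity
   of the operation is expressed with a product of neighbourhood filters. *)
class linear_topological_space = topological_ab_group_add + real_vector +
  assumes tendsto_scaleR_Pair:
    "LIM p (nhds (c::real) \<times>\<^sub>F nhds a). fst p *\<^sub>R snd p :> nhds (c *\<^sub>R a)"

instance real_normed_vector < linear_topological_space
  by standard
    (intro tendsto_scaleR filterlim_fst filterlim_snd)

definition quasi_concave_on :: "'a::real_vector set \<Rightarrow> ('a \<Rightarrow> real) \<Rightarrow> bool" where
  "quasi_concave_on A f \<longleftrightarrow>
     (\<forall>a\<in>A. \<forall>b\<in>A. \<forall>t\<in>{0..1}. min (f a) (f b) \<le> f ((1 - t) *\<^sub>R a + t *\<^sub>R b))"

definition quasi_convex_on :: "'a::real_vector set \<Rightarrow> ('a \<Rightarrow> real) \<Rightarrow> bool" where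
  "quasi_convex_on A f \<longleftrightarrow>
     (\<forall>a\<in>A. \<forall>b\<in>A. \<forall>t\<in>{0..1}. f ((1 - t) *\<^sub>R a + t *\<^sub>R b) \<le> max (f a) (f b))"

(* Attained maximum and minimum values over a possibly infinite set, where
   Max and Min are not applicable. As usual with THE-style operators,
   they are unspecified if the value is not attained. *)
definition max_over :: "'a set \<Rightarrow> ('a \<Rightarrow> real) \<Rightarrow> real" where
  "max_over A f = (GREATEST v. v \<in> f ` A)"

definition min_over :: "'a set \<Rightarrow> ('a \<Rightarrow> real) \<Rightarrow> real" where
  "min_over A f = (LEAST v. v \<in> f ` A)"

definition argmax_set :: "'a set \<Rightarrow> ('a \<Rightarrow> real) \<Rightarrow> 'a set" where
  "argmax_set A f = {a. is_arg_max f (\<lambda>x. x \<in> A) a}"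

definition argmin_set :: "'a set \<Rightarrow> ('a \<Rightarrow> real) \<Rightarrow> 'a set" where
  "argmin_set A f = {a. is_arg_min f (\<lambda>x. x \<in> A) a}"

(* In F a b the first argument belongs to the maximizing player and the second
   one to the minimizing player; both choose from the same set A. *)
definition maximin :: "'a set \<Rightarrow> ('a \<Rightarrow> 'a \<Rightarrow> real) \<Rightarrow> real" where
  "maximin A F = max_over A (\<lambda>a. min_over A (\<lambda>b. F a b))"

definition minimax :: "'a set \<Rightarrow> ('a \<Rightarrow> 'a \<Rightarrow> real) \<Rightarrow> real" where
  "minimax A F = min_over A (\<lambda>b. max_over A (\<lambda>a. F a b))"

definition maximin_strategies :: "'a set \<Rightarrow> ('a \<Rightarrow> 'a \<Rightarrow> real) \<Rightarrow> 'a set" where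
  "maximin_strategies A F = argmax_set A (\<lambda>a. min_over A (\<lambda>b. F a b))"

definition minimax_strategies :: "'a set \<Rightarrow> ('a \<Rightarrow> 'a \<Rightarrow> real) \<Rightarrow> 'a set" where
  "minimax_strategies A F = argmin_set A (\<lambda>b. max_over A (\<lambda>a. F a b))"

(* The two groups may use strategies from different linear topological spaces,
   so a strategy profile is a pair (x, y): x gives the strategies of the players
   1..m and y those of the players m+1..n. Both components are extensional,
   so that profiles correspond exactly to the points of S_1 x ... x S_n. *)
definition profiles ::
  "nat \<Rightarrow> nat \<Rightarrow> 'a set \<Rightarrow> 'b set \<Rightarrow> ((nat \<Rightarrow> 'a) \<times> (nat \<Rightarrow> 'b)) set" where
  "profiles m n S S' = ({1..m} \<rightarrow>\<^sub>E S) \<times> ({m+1..n} \<rightarrow>\<^sub>E S')"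

definition profile_topology ::
  "nat \<Rightarrow> nat \<Rightarrow> 'a::topological_space set \<Rightarrow> 'b::topological_space set
     \<Rightarrow> ((nat \<Rightarrow> 'a) \<times> (nat \<Rightarrow> 'b)) topology" where
  "profile_topology m n S S' =
     prod_topology (product_topology (\<lambda>_. top_of_set S) {1..m})
                   (product_topology (\<lambda>_. top_of_set S') {m+1..n})"

lemma topspace_profile_topology: "topspace (profile_topology m n S S') = profiles m n S S'"
  by (simp add: profile_topology_def profiles_def topspace_product_topology)

locale two_group_game =
  fixes m n :: nat
    and S :: "'a::linear_topological_space set"
    and S' :: "'b::linear_topological_space set"
    and u :: "nat \<Rightarrow> (nat \<Rightarrow> 'a) \<times> (nat \<Rightarrow> 'b) \<Rightarrow> real"
  assumes players: "4 \<le> n" "2 \<le> m" "m \<le> n - 2"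
    and strategies1: "S \<noteq> {}" "convex S" "compact S"
    and strategies2: "S' \<noteq> {}" "convex S'" "compact S'"
    and continuous:
      "\<And>i. i \<in> {1..n} \<Longrightarrow> continuous_map (profile_topology m n S S') euclideanreal (u i)"
    and quasi_concave1:
      "\<And>i x y. \<lbrakk>i \<in> {1..m}; (x, y) \<in> profiles m n S S'\<rbrakk>
         \<Longrightarrow> quasi_concave_on S (\<lambda>a. u i (x(i := a), y))"
    and quasi_concave2:
      "\<And>k x y. \<lbrakk>k \<in> {m+1..n}; (x, y) \<in> profiles m n S S'\<rbrakk>
         \<Longrightarrow> quasi_concave_on S' (\<lambda>a. u k (x, y(k := a)))"
    and quasi_convex1:
      "\<And>i j x y. \<lbrakk>i \<in> {1..n}; j \<in> {1..m}; j \<noteq> i; (x, y) \<in> profiles m n S S'\<rbrakk>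
         \<Longrightarrow> quasi_convex_on S (\<lambda>a. u i (x(j := a), y))"
    and quasi_convex2:
      "\<And>i l x y. \<lbrakk>i \<in> {1..n}; l \<in> {m+1..n}; l \<noteq> i; (x, y) \<in> profiles m n S S'\<rbrakk>
         \<Longrightarrow> quasi_convex_on S' (\<lambda>a. u i (x, y(l := a)))"
    and zero_sum1:
      "\<And>s. s \<in> profiles m n S S' \<Longrightarrow> (\<Sum>i\<in>{1..m}. u i s) = 0"
    and zero_sum2:
      "\<And>s. s \<in> profiles m n S S' \<Longrightarrow> (\<Sum>k\<in>{m+1..n}. u k s) = 0"
    and symmetric:
      "\<And>\<pi> i x y. \<lbrakk>\<pi> permutes {1..n}; \<pi> ` {1..m} = {1..m}; \<pi> ` {m+1..n} = {m+1..n};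
                   i \<in> {1..n}; (x, y) \<in> profiles m n S S'\<rbrakk>
         \<Longrightarrow> u (\<pi> i) (x, y) = u i (restrict (x \<circ> \<pi>) {1..m}, restrict (y \<circ> \<pi>) {m+1..n})"
    and unique_maximin1:
      "\<And>i j x y. \<lbrakk>i \<in> {1..m}; j \<in> {1..m}; i \<noteq> j; (x, y) \<in> profiles m n S S'\<rbrakk>
         \<Longrightarrow> is_singleton (maximin_strategies S (\<lambda>a b. u i (x(i := a, j := b), y)))"
    and unique_minimax1:
      "\<And>i j x y. \<lbrakk>i \<in> {1..m}; j \<in> {1..m}; i \<noteq> j; (x, y) \<in> profiles m n S S'\<rbrakk>
         \<Longrightarrow> is_singleton (minimax_strategies S (\<lambda>a b. u i (x(i := a, j := b), y)))"
    and unique_maximin2: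
      "\<And>k l x y. \<lbrakk>k \<in> {m+1..n}; l \<in> {m+1..n}; k \<noteq> l; (x, y) \<in> profiles m n S S'\<rbrakk>
         \<Longrightarrow> is_singleton (maximin_strategies S' (\<lambda>a b. u k (x, y(k := a, l := b))))"
    and unique_minimax2:
      "\<And>k l x y. \<lbrakk>k \<in> {m+1..n}; l \<in> {m+1..n}; k \<noteq> l; (x, y) \<in> profiles m n S S'\<rbrakk>
         \<Longrightarrow> is_singleton (minimax_strategies S' (\<lambda>a b. u k (x, y(k := a, l := b))))"
    and unique_best_response1:
      "\<And>i x y. \<lbrakk>i \<in> {1..m}; (x, y) \<in> profiles m n S S'\<rbrakk>
         \<Longrightarrow> is_singleton (argmax_set S (\<lambda>a. u i (x(i := a), y)))"
    and unique_best_response2: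
      "\<And>k x y. \<lbrakk>k \<in> {m+1..n}; (x, y) \<in> profiles m n S S'\<rbrakk>
         \<Longrightarrow> is_singleton (argmax_set S' (\<lambda>a. u k (x, y(k := a))))"

definition nash_equilibrium ::
  "nat \<Rightarrow> nat \<Rightarrow> 'a set \<Rightarrow> 'b set \<Rightarrow> (nat \<Rightarrow> (nat \<Rightarrow> 'a) \<times> (nat \<Rightarrow> 'b) \<Rightarrow> real)
     \<Rightarrow> (nat \<Rightarrow> 'a) \<times> (nat \<Rightarrow> 'b) \<Rightarrow> bool" where
  "nash_equilibrium m n S S' u = (\<lambda>(x, y).
     (x, y) \<in> profiles m n S S' \<and>
     (\<forall>i\<in>{1..m}. \<forall>a\<in>S. u i (x, y) \<ge> u i (x(i := a), y)) \<and>
     (\<forall>k\<in>{m+1..n}. \<forall>a\<in>S'. u k (x, y) \<ge> u k (x, y(k := a))))"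

definition uniform_profile ::
  "nat \<Rightarrow> nat \<Rightarrow> 'a \<Rightarrow> 'b \<Rightarrow> (nat \<Rightarrow> 'a) \<times> (nat \<Rightarrow> 'b)" where
  "uniform_profile m n a b = ((\<lambda>_\<in>{1..m}. a), (\<lambda>_\<in>{m+1..n}. b))"

(* The payoff of player i at (s_i, s_j, s~, ..., s~, s^, ..., s^), as a function of
   s_i and s_j, for i and j in the first group, and its analogue
   (s~, ..., s~, s_k, s_l, s^, ..., s^) for k and l in the second group. *)
definition payoff1 ::
  "nat \<Rightarrow> nat \<Rightarrow> (nat \<Rightarrow> (nat \<Rightarrow> 'a) \<times> (nat \<Rightarrow> 'b) \<Rightarrow> real) \<Rightarrow> 'a \<Rightarrow> 'b
     \<Rightarrow> nat \<Rightarrow> nat \<Rightarrow> 'a \<Rightarrow> 'a \<Rightarrow> real" where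
  "payoff1 m n u st sh i j a b =
     u i ((\<lambda>_\<in>{1..m}. st)(i := a, j := b), (\<lambda>_\<in>{m+1..n}. sh))"

definition payoff2 ::
  "nat \<Rightarrow> nat \<Rightarrow> (nat \<Rightarrow> (nat \<Rightarrow> 'a) \<times> (nat \<Rightarrow> 'b) \<Rightarrow> real) \<Rightarrow> 'a \<Rightarrow> 'b
     \<Rightarrow> nat \<Rightarrow> nat \<Rightarrow> 'b \<Rightarrow> 'b \<Rightarrow> real" where
  "payoff2 m n u st sh k l a b =
     u k ((\<lambda>_\<in>{1..m}. st), (\<lambda>_\<in>{m+1..n}. sh)(k := a, l := b))"

end

theory Submission
  imports Defs
begin

text \<open>Let \<open>F a b\<close> be the payoff of player \<open>i\<close> when \<open>i\<close> and another player \<open>j\<close> of the same group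
  play \<open>a\<close> and \<open>b\<close> while everyone else follows the profile given by the coincidence hypothesis.
  A strategy \<open>c\<close> that is both maximin and minimax satisfies
  \<open>F a c \<le> max F(-, c) = min F(c, -) \<le> F c c\<close>, the middle equality being the minimax
  equality. Since \<open>j\<close> playing \<open>c\<close> is the prescribed behaviour, this says that player \<open>i\<close> cannot
  gain by deviating.\<close>

lemma max_over_eq:
  assumes "c \<in> A" "\<And>a. a \<in> A \<Longrightarrow> f a \<le> f c"
  shows "max_over A f = f c"
  unfolding max_over_def using assms by (intro Greatest_equality) auto

lemma min_over_eq:
  assumes "c \<in> A" "\<And>a. a \<in> A \<Longrightarrow> f c \<le> f a"
  shows "min_over A f = f c"
  unfolding min_over_def using assms by (intro Least_equality) auto

lemma argmax_set_iff: "c \<in> argmax_set A f \<longleftrightarrow> c \<in> A \<and> (\<forall>a\<in>A. f a \<le> f c)"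
  unfolding argmax_set_def is_arg_max_def by (auto simp: not_less)

lemma argmin_set_iff: "c \<in> argmin_set A f \<longleftrightarrow> c \<in> A \<and> (\<forall>a\<in>A. f c \<le> f a)"
  unfolding argmin_set_def is_arg_min_def by (auto simp: not_less)

text \<open>Compactness and continuity make the maximum attained; without a maximizer the value of
  \<open>max_over\<close> would be unspecified and could bound nothing.\<close>

lemma le_max_over:
  assumes "compact A" "continuous_on A f" "a \<in> A"
  shows "f a \<le> max_over A f"
proof -
  obtain c where "c \<in> A" "\<forall>x\<in>A. f x \<le> f c"
    using continuous_attains_sup[of A f] assms by auto
  then show ?thesis
    using assms(3) max_over_eq[of c A f] by simp
qed

lemma min_over_le:
  assumes "compact A" "continuous_on A f" "a \<in> A"
  shows "min_over A f \<le> f a"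
proof -
  obtain c where "c \<in> A" "\<forall>x\<in>A. f c \<le> f x"
    using continuous_attains_inf[of A f] assms by auto
  then show ?thesis
    using assms(3) min_over_eq[of c A f] by simp
qed

text \<open>Continuity of the row and the column through \<open>c\<close> makes the two outer
  extrema attained. The extrema in the middle of the chain are attained at \<open>c\<close> by the
  two membership assumptions.\<close>

lemma coincidence_imp_best_response:
  fixes A :: "'a::topological_space set"
  assumes "compact A" "continuous_on A (F c)" "continuous_on A (\<lambda>a. F a c)"
    and "maximin A F = minimax A F"
    and "c \<in> maximin_strategies A F" "c \<in> minimax_strategies A F"
    and "a \<in> A"
  shows "F a c \<le> F c c"
proof -
  have c: "c \<in> A"
    using assms by (simp add: maximin_strategies_def argmax_set_iff)
  have "F a c \<le> max_over A (\<lambda>a. F a c)"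
    using assms by (intro le_max_over)
  also have "\<dots> = minimax A F"
    using assms unfolding minimax_def minimax_strategies_def argmin_set_iff
    by (intro min_over_eq[symmetric]) auto
  also have "\<dots> = maximin A F"
    using assms by simp
  also have "\<dots> = min_over A (F c)"
    using assms unfolding maximin_def maximin_strategies_def argmax_set_iff
    by (intro max_over_eq) auto
  also have "\<dots> \<le> F c c"
    using assms c by (intro min_over_le)
  finally show ?thesis .
qed

context two_group_game
begin

text \<open>The deviator \<open>j\<close> may differ from the player \<open>i\<close> whose payoff
  is observed: \<open>j = i\<close> serves for columns of the two-player game,
  \<open>j \<noteq> i\<close> for rows.\<close>

lemma continuous_on_deviation1:
  assumes "i \<in> {1..n}" "j \<in> {1..m}" "(x, y) \<in> profiles m n S S'"
  shows "continuous_on S (\<lambda>a. u i (x(j := a), y))"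
proof -
  have "continuous_map (top_of_set S) (profile_topology m n S S') (\<lambda>a. (x(j := a), y))"
    unfolding profile_topology_def
  proof (intro continuous_map_pairedI)
    \<comment> \<open>Coordinate \<open>j\<close> of the deviating profile is the identity in
      \<open>a\<close>, every other coordinate is constant. The update stays extensional because
      \<open>j\<close> lies in the index set.\<close>
    have "continuous_map (top_of_set S) (top_of_set S) (\<lambda>a. (x(j := a)) k)" if "k \<in> {1..m}" for k
      using assms that by (cases "k = j") (auto simp: profiles_def)
    then show "continuous_map (top_of_set S) (product_topology (\<lambda>_. top_of_set S) {1..m})
        (\<lambda>a. x(j := a))"
      using assms by (auto simp: continuous_map_componentwise profiles_def PiE_def extensional_def)
  qed (use assms in \<open>auto simp: profiles_def topspace_product_topology\<close>)
  then have "continuous_map (top_of_set S) euclideanreal (u i \<circ> (\<lambda>a. (x(j := a), y)))"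
    using continuous[OF assms(1)] by (rule continuous_map_compose)
  then show ?thesis
    by (simp add: comp_def)
qed

lemma continuous_on_deviation2:
  assumes "i \<in> {1..n}" "l \<in> {m+1..n}" "(x, y) \<in> profiles m n S S'"
  shows "continuous_on S' (\<lambda>a. u i (x, y(l := a)))"
proof -
  have "continuous_map (top_of_set S') (profile_topology m n S S') (\<lambda>a. (x, y(l := a)))"
    unfolding profile_topology_def
  proof (intro continuous_map_pairedI)
    have "continuous_map (top_of_set S') (top_of_set S') (\<lambda>a. (y(l := a)) k)"
      if "k \<in> {m+1..n}" for k
      using assms that by (cases "k = l") (auto simp: profiles_def)
    then show "continuous_map (top_of_set S') (product_topology (\<lambda>_. top_of_set S') {m+1..n})
        (\<lambda>a. y(l := a))"
      using assms by (auto simp: continuous_map_componentwise profiles_def PiE_def extensional_def)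
  \<comment> \<open>What remains is the first component, which is constant in
    \<open>a\<close>.\<close>
  qed (use assms in \<open>auto simp: profiles_def topspace_product_topology\<close>)
  then have "continuous_map (top_of_set S') euclideanreal (u i \<circ> (\<lambda>a. (x, y(l := a))))"
    using continuous[OF assms(1)] by (rule continuous_map_compose)
  then show ?thesis
    by (simp add: comp_def)
qed

lemma uniform_profile_in_profiles:
  "a \<in> S \<Longrightarrow> b \<in> S' \<Longrightarrow> uniform_profile m n a b \<in> profiles m n S S'"
  by (auto simp: uniform_profile_def profiles_def)

end

theorem theorem2:
  fixes m n :: nat
    and S :: "'a::linear_topological_space set"
    and S' :: "'b::linear_topological_space set"
    and u :: "nat \<Rightarrow> (nat \<Rightarrow> 'a) \<times> (nat \<Rightarrow> 'b) \<Rightarrow> real"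
  assumes game: "two_group_game m n S S' u"
    and coincidence:
      "\<exists>st\<in>S. \<exists>sh\<in>S'.
         (\<forall>i\<in>{1..m}. \<forall>j\<in>{1..m}. i \<noteq> j \<longrightarrow>
            maximin S (payoff1 m n u st sh i j) = minimax S (payoff1 m n u st sh i j) \<and>
            maximin_strategies S (payoff1 m n u st sh i j) = {st} \<and>
            minimax_strategies S (payoff1 m n u st sh i j) = {st}) \<and>
         (\<forall>k\<in>{m+1..n}. \<forall>l\<in>{m+1..n}. k \<noteq> l \<longrightarrow>
            maximin S' (payoff2 m n u st sh k l) = minimax S' (payoff2 m n u st sh k l) \<and>
            maximin_strategies S' (payoff2 m n u st sh k l) = {sh} \<and>
            minimax_strategies S' (payoff2 m n u st sh k l) = {sh})"
  shows "\<exists>a\<in>S. \<exists>b\<in>S'. nash_equilibrium m n S S' u (uniform_profile m n a b)"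
proof -
  interpret two_group_game m n S S' u
    by (rule game)
  obtain st sh where st: "st \<in> S" and sh: "sh \<in> S'"
    and co1: "\<And>i j. \<lbrakk>i \<in> {1..m}; j \<in> {1..m}; i \<noteq> j\<rbrakk> \<Longrightarrow>
        maximin S (payoff1 m n u st sh i j) = minimax S (payoff1 m n u st sh i j) \<and>
        st \<in> maximin_strategies S (payoff1 m n u st sh i j) \<and>
        st \<in> minimax_strategies S (payoff1 m n u st sh i j)"
    and co2: "\<And>k l. \<lbrakk>k \<in> {m+1..n}; l \<in> {m+1..n}; k \<noteq> l\<rbrakk> \<Longrightarrow>
        maximin S' (payoff2 m n u st sh k l) = minimax S' (payoff2 m n u st sh k l) \<and>
        sh \<in> maximin_strategies S' (payoff2 m n u st sh k l) \<and>
        sh \<in> minimax_strategies S' (payoff2 m n u st sh k l)"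
    \<comment> \<open>The singleton equations become memberships, the form that
      \<open>coincidence_imp_best_response\<close> takes.\<close>
    using coincidence by (elim bexE conjE) (metis singletonI)
  define x where "x = (\<lambda>_\<in>{1..m}. st)"
  define y where "y = (\<lambda>_\<in>{m+1..n}. sh)"
  have xy: "(x, y) \<in> profiles m n S S'"
    using uniform_profile_in_profiles[OF st sh] by (simp add: uniform_profile_def x_def y_def)
  have x_upd: "x(i := st) = x" if "i \<in> {1..m}" for i
    using that by (auto simp: x_def)
  have y_upd: "y(k := sh) = y" if "k \<in> {m+1..n}" for k
    using that by (auto simp: y_def)
  have "u i (x(i := a), y) \<le> u i (x, y)" if i: "i \<in> {1..m}" and a: "a \<in> S" for i a
  proof -
    \<comment> \<open>Since \<open>m \<ge> 2\<close>, player \<open>i\<close> has a partner in the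
      first group.\<close>
    obtain j where j: "j \<in> {1..m}" "i \<noteq> j"
    proof (cases "i = 1")
      case True
      then show ?thesis
        using that[of 2] players by auto
    next
      case False
      then show ?thesis
        using that[of 1] players by auto
    qed
    let ?F = "payoff1 m n u st sh i j"
    have i_n: "i \<in> {1..n}"
      using i players by auto
    \<comment> \<open>With \<open>i\<close> at \<open>st\<close> only \<open>j\<close> deviates from
      the uniform profile.\<close>
    have row: "?F st = (\<lambda>b. u i (x(j := b), y))"
      by (rule ext) (simp only: payoff1_def x_upd[OF i] flip: x_def y_def)
    \<comment> \<open>Swapping the two updates puts \<open>j := st\<close> innermost, where it
      changes nothing; only the deviation of \<open>i\<close> is left.\<close>
    have column: "?F b st = u i (x(i := b), y)" for b
      by (simp only: payoff1_def fun_upd_twist[OF j(2)] x_upd[OF j(1)] flip: x_def y_def)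
    have "?F a st \<le> ?F st st"
      using co1[OF i j] a strategies1
        continuous_on_deviation1[OF i_n i xy] continuous_on_deviation1[OF i_n j(1) xy]
      by (intro coincidence_imp_best_response[of S]) (simp_all only: row column)
    then show ?thesis
      by (simp only: column x_upd[OF i])
  qed
  moreover have "u k (x, y(k := a)) \<le> u k (x, y)" if k: "k \<in> {m+1..n}" and a: "a \<in> S'" for k a
  proof -
    \<comment> \<open>Here \<open>m \<le> n - 2\<close> places both \<open>m + 1\<close> and
      \<open>m + 2\<close> in the second group.\<close>
    obtain l where l: "l \<in> {m+1..n}" "k \<noteq> l"
    proof (cases "k = m + 1")
      case True
      then show ?thesis
        using that[of "m + 2"] players by auto
    next
      case False
      then show ?thesis
        using that[of "m + 1"] players by auto
    qed
    let ?F = "payoff2 m n u st sh k l"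
    have k_n: "k \<in> {1..n}"
      using k by auto
    have row: "?F sh = (\<lambda>b. u k (x, y(l := b)))"
      by (rule ext) (simp only: payoff2_def y_upd[OF k] flip: x_def y_def)
    have column: "?F b sh = u k (x, y(k := b))" for b
      by (simp only: payoff2_def fun_upd_twist[OF l(2)] y_upd[OF l(1)] flip: x_def y_def)
    have "?F a sh \<le> ?F sh sh"
      using co2[OF k l] a strategies2
        continuous_on_deviation2[OF k_n k xy] continuous_on_deviation2[OF k_n l(1) xy]
      by (intro coincidence_imp_best_response[of S']) (simp_all only: row column)
    then show ?thesis
      by (simp only: column y_upd[OF k])
  qed
  \<comment> \<open>The witnesses are the strategies \<open>st\<close> and \<open>sh\<close> of the
    coincidence hypothesis themselves: neither group has a profitable unilateral deviation.\<close>
  ultimately have "nash_equilibrium m n S S' u (uniform_profile m n st sh)"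
    using xy unfolding nash_equilibrium_def uniform_profile_def x_def[symmetric] y_def[symmetric]
    by blast
  then show ?thesis
    using st sh by blast
qed

end
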